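(* Suppose that every round-$j$ profile $P^j$ is single-peaked with respect to a given axis or single-crossing with respect to a given voter order; the axes and orders may differ across rounds. Then the ordered budget rule is a polynomial-time semi-online rule, and for every group $S$ the winner is Pareto efficient for $S$ in at least $\lceil(|T|+1)|S|/n\rceil-1$ rounds. In particular, it satisfies all-rank-wPJR, with the stronger Droop size condition $|S|>\ell n/(|T|+1)$ (in place of $|S|\ge\ell n/|T|$).
   Context: Model. Voters $V=[n]$, a set $C$ of $m$ candidates, rounds $T=\{1,\dots,|T|\}$ with $n,m,|T|\ge1$; $|T|$ is the horizon. In each round $j$ each voter $i$ has a strict complete ranking $\succ_i^j$ of $C$; $P^j$ is the tuple of round-$j$ rankings. A voter's first choice (peak) is her most-preferred candidate. For $r\in[m]$, $A_i^j(r)$ is the set of voter $i$'s $r$ most-preferred candidates in round $j$. A sequence is $W=(w^1,\dots,w^{|T|})\in C^{|T|}$; $w^j$ is the winner of round $j$. A group is a nonempty $S\subseteq V$. A rule is semi-online if each $w^j$ depends only on the rankings (and given axes/orders) of rounds $1,\dots,j$ and on $|T|$. Domains. $P^j$ is single-peaked with respect to a linear order (axis) of $C$ if, for every voter, candidates are ranked lower as one moves away from her peak along the axis in either direction. It is single-crossing with respect to a linear order of $V$ if, for every pair of candidates $a,b$, the voters who prefer $a$ to $b$ form a prefix or a suffix of that order. Pareto efficiency. A candidate is Pareto efficient for $S$ in round $j$ if there is no candidate $c$ that every $i\in S$ ranks above it in round $j$. All-rank-wPJR. For every rank matrix $R=(r_i^j)\in[m]^{|T|\times n}$, every positive integer $\ell$,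 and every group $S$ with $|S|\ge\ell n/|T|$ such that $\bigcap_{i\in S}A_i^j(r_i^j)\ne\varnothing$ for all $j\in T$, there are at least $\ell$ rounds $j$ with $w^j\in\bigcup_{i\in S}A_i^j(r_i^j)$. With the Droop size condition, the hypothesis $|S|\ge\ell n/|T|$ is replaced by $|S|>\ell n/(|T|+1)$. Ordered budget rule. Set $b_i\gets|T|+1$ for every voter. In each round $j=1,\dots,|T|$: order the voters by the given single-crossing order of round $j$, or by their peaks on the given axis of round $j$ (ties by voter index); deduct a total of $n$ units from the budgets in this order, exhausting each budget before moving to the next voter and stopping as soon as $n$ units have been deducted; let $w^j$ be the round-$j$ first choice of the last voter whose budget decreased. *)

theory Defs
  imports Complex_Main "HOL-Combinatorics.Multiset_Permutations"
begin

section \<open>Elections over several rounds\<close>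

text \<open>
  A linear order of a finite set \<open>A\<close> is represented by the list of its elements, i.e. by a member
  of \<open>permutations_of_set A\<close>. Rankings list the most-preferred candidate first.
\<close>

datatype 'c given_order =
    Axis "'c list"
  | Voter_Order "nat list"

record 'c election =
  num_voters :: nat
  cands :: "'c set"
  horizon :: nat
  ranking :: "nat \<Rightarrow> nat \<Rightarrow> 'c list" \<comment> \<open>\<open>ranking E j i\<close>: round \<open>j\<close>, voter \<open>i\<close>\<close>
  given :: "nat \<Rightarrow> 'c given_order"

definition voters :: "'c election \<Rightarrow> nat set" where
  "voters E = {1..num_voters E}"

definition rounds :: "'c election \<Rightarrow> nat set" where
  "rounds E = {1..horizon E}"

definition is_election :: "'c election \<Rightarrow> bool" where
  "is_election E \<longleftrightarrow>
     num_voters E \<ge> 1 \<and> finite (cands E) \<and> card (cands E) \<ge> 1 \<and> horizon E \<ge> 1 \<and>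
     (\<forall>j\<in>rounds E. \<forall>i\<in>voters E. ranking E j i \<in> permutations_of_set (cands E))"

definition pos :: "'a list \<Rightarrow> 'a \<Rightarrow> nat" where
  "pos xs x = length (takeWhile (\<lambda>y. y \<noteq> x) xs)"

definition prefers :: "'c election \<Rightarrow> nat \<Rightarrow> nat \<Rightarrow> 'c \<Rightarrow> 'c \<Rightarrow> bool" where
  "prefers E j i a b \<longleftrightarrow> pos (ranking E j i) a < pos (ranking E j i) b"

definition peak :: "'c election \<Rightarrow> nat \<Rightarrow> nat \<Rightarrow> 'c" where
  "peak E j i = hd (ranking E j i)"

definition top_set :: "'c election \<Rightarrow> nat \<Rightarrow> nat \<Rightarrow> nat \<Rightarrow> 'c set" where
  "top_set E j i r = set (take r (ranking E j i))"

definition single_peaked :: "'c election \<Rightarrow> nat \<Rightarrow> 'c list \<Rightarrow> bool" where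
  "single_peaked E j ax \<longleftrightarrow>
     (\<forall>i\<in>voters E. \<forall>a\<in>cands E. \<forall>b\<in>cands E.
        (pos ax (peak E j i) \<le> pos ax a \<and> pos ax a < pos ax b \<or>
         pos ax b < pos ax a \<and> pos ax a \<le> pos ax (peak E j i))
        \<longrightarrow> prefers E j i a b)"

definition single_crossing :: "'c election \<Rightarrow> nat \<Rightarrow> nat list \<Rightarrow> bool" where
  "single_crossing E j vs \<longleftrightarrow>
     (\<forall>a\<in>cands E. \<forall>b\<in>cands E.
        \<exists>k. {i \<in> voters E. prefers E j i a b} = set (take k vs) \<or>
            {i \<in> voters E. prefers E j i a b} = set (drop k vs))"

definition structured :: "'c election \<Rightarrow> bool" where
  "structured E \<longleftrightarrow> is_election E \<and>
     (\<forall>j\<in>rounds E. case given E j of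
        Axis ax \<Rightarrow> ax \<in> permutations_of_set (cands E) \<and> single_peaked E j ax
      | Voter_Order vs \<Rightarrow> vs \<in> permutations_of_set (voters E) \<and> single_crossing E j vs)"

definition pareto_efficient :: "'c election \<Rightarrow> nat \<Rightarrow> nat set \<Rightarrow> 'c \<Rightarrow> bool" where
  "pareto_efficient E j S w \<longleftrightarrow>
     w \<in> cands E \<and> \<not> (\<exists>c\<in>cands E. \<forall>i\<in>S. prefers E j i c w)"

definition is_group :: "'c election \<Rightarrow> nat set \<Rightarrow> bool" where
  "is_group E S \<longleftrightarrow> S \<noteq> {} \<and> S \<subseteq> voters E"


section \<open>All-rank-wPJR\<close>

text \<open>\<open>large l S\<close> is the size condition that entitles the group \<open>S\<close> to \<open>l\<close> rounds.\<close>

definition all_rank_wPJR_sized ::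
  "(nat \<Rightarrow> nat set \<Rightarrow> bool) \<Rightarrow> 'c election \<Rightarrow> (nat \<Rightarrow> 'c) \<Rightarrow> bool" where
  "all_rank_wPJR_sized large E W \<longleftrightarrow>
     (\<forall>R :: nat \<Rightarrow> nat \<Rightarrow> nat. \<forall>l S.
        (\<forall>j\<in>rounds E. \<forall>i\<in>voters E. R j i \<in> {1..card (cands E)}) \<and>
        l \<ge> 1 \<and> is_group E S \<and> large l S \<and>
        (\<forall>j\<in>rounds E. (\<Inter>i\<in>S. top_set E j i (R j i)) \<noteq> {})
        \<longrightarrow> card {j \<in> rounds E. W j \<in> (\<Union>i\<in>S. top_set E j i (R j i))} \<ge> l)"

definition all_rank_wPJR :: "'c election \<Rightarrow> (nat \<Rightarrow> 'c) \<Rightarrow> bool" where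
  "all_rank_wPJR E = all_rank_wPJR_sized
     (\<lambda>l S. real (card S) \<ge> real l * real (num_voters E) / real (horizon E)) E"

definition all_rank_wPJR_Droop :: "'c election \<Rightarrow> (nat \<Rightarrow> 'c) \<Rightarrow> bool" where
  "all_rank_wPJR_Droop E = all_rank_wPJR_sized
     (\<lambda>l S. real (card S) > real l * real (num_voters E) / (real (horizon E) + 1)) E"


section \<open>The ordered budget rule\<close>

text \<open>\<open>sort_key\<close> is stable, so voters with the same peak stay ordered by index.\<close>

definition voter_sequence :: "'c election \<Rightarrow> nat \<Rightarrow> nat list" where
  "voter_sequence E j = (case given E j of
     Axis ax \<Rightarrow> sort_key (\<lambda>i. pos ax (peak E j i)) [1..<Suc (num_voters E)]
   | Voter_Order vs \<Rightarrow> vs)"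

fun deduct :: "nat \<Rightarrow> nat list \<Rightarrow> (nat \<Rightarrow> nat) \<Rightarrow> (nat \<Rightarrow> nat)" where
  "deduct d [] b = b"
| "deduct d (i # is) b =
     (let x = min d (b i) in deduct (d - x) is (b(i := b i - x)))"

primrec budgets :: "'c election \<Rightarrow> nat \<Rightarrow> (nat \<Rightarrow> nat)" where
  "budgets E 0 = (\<lambda>i. horizon E + 1)"
| "budgets E (Suc j) = deduct (num_voters E) (voter_sequence E (Suc j)) (budgets E j)"

definition ordered_budget_rule :: "'c election \<Rightarrow> nat \<Rightarrow> 'c" where
  "ordered_budget_rule E j =
     peak E j (last (filter (\<lambda>i. budgets E j i < budgets E (j - 1) i) (voter_sequence E j)))"


section \<open>Semi-online rules\<close>

text \<open>\<open>D\<close> is the domain of elections on which the rule is used.\<close>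

definition rule_on :: "('c election \<Rightarrow> bool) \<Rightarrow> ('c election \<Rightarrow> nat \<Rightarrow> 'c) \<Rightarrow> bool" where
  "rule_on D f \<longleftrightarrow> (\<forall>E. D E \<longrightarrow> (\<forall>j\<in>rounds E. f E j \<in> cands E))"

definition semi_online :: "('c election \<Rightarrow> bool) \<Rightarrow> ('c election \<Rightarrow> nat \<Rightarrow> 'c) \<Rightarrow> bool" where
  "semi_online D f \<longleftrightarrow>
     (\<forall>E E'. D E \<and> D E' \<and>
        num_voters E = num_voters E' \<and> cands E = cands E' \<and> horizon E = horizon E' \<longrightarrow>
        (\<forall>j\<in>rounds E.
           (\<forall>k\<in>{1..j}. given E k = given E' k \<and>
              (\<forall>i\<in>voters E. ranking E k i = ranking E' k i))
           \<longrightarrow> f E j = f E' j))"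


section \<open>Polynomial time\<close>

text \<open>
  Running times are those of programs of a small imperative language over natural numbers with
  arrays of any dimension (a scalar is an array with the empty index list). Each assignment and
  each test takes one step, whatever expressions it contains; the expressions are part of the
  fixed program, so this only affects constant factors. There is no multiplication:
  by addition and truncated subtraction alone, a program running for \<open>t\<close> steps
  only creates numbers of \<open>O(t + k)\<close> bits, where \<open>k\<close> bounds the bit length of the input numbers.
  Hence polynomial time here is polynomial time on a Turing machine.
\<close>

datatype aexp =
    Num nat
  | Arr string "aexp list"
  | Add aexp aexp
  | Sub aexp aexp

datatype bexp = Less aexp aexp | Equal aexp aexp

datatype com =
    Skip
  | Assign string "aexp list" aexp
  | Seq com com
  | Cond bexp com com
  | While bexp com

type_synonym store = "string \<Rightarrow> nat list \<Rightarrow> nat"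

fun aval :: "aexp \<Rightarrow> store \<Rightarrow> nat" where
  "aval (Num k) s = k"
| "aval (Arr x es) s = s x (map (\<lambda>e. aval e s) es)"
| "aval (Add e1 e2) s = aval e1 s + aval e2 s"
| "aval (Sub e1 e2) s = aval e1 s - aval e2 s"

fun bval :: "bexp \<Rightarrow> store \<Rightarrow> bool" where
  "bval (Less e1 e2) s \<longleftrightarrow> aval e1 s < aval e2 s"
| "bval (Equal e1 e2) s \<longleftrightarrow> aval e1 s = aval e2 s"

text \<open>\<open>exec c s t s'\<close>: started in \<open>s\<close>, the program \<open>c\<close> halts in \<open>s'\<close> after exactly \<open>t\<close> steps.\<close>

inductive exec :: "com \<Rightarrow> store \<Rightarrow> nat \<Rightarrow> store \<Rightarrow> bool" where
  Skip: "exec Skip s 1 s"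
| Assign: "exec (Assign x es e) s 1
     (s(x := (s x)(map (\<lambda>e. aval e s) es := aval e s)))"
| Seq: "exec c1 s1 t1 s2 \<Longrightarrow> exec c2 s2 t2 s3 \<Longrightarrow> exec (Seq c1 c2) s1 (t1 + t2) s3"
| CondTrue: "bval b s \<Longrightarrow> exec c1 s t s' \<Longrightarrow> exec (Cond b c1 c2) s (Suc t) s'"
| CondFalse: "\<not> bval b s \<Longrightarrow> exec c2 s t s' \<Longrightarrow> exec (Cond b c1 c2) s (Suc t) s'"
| WhileFalse: "\<not> bval b s \<Longrightarrow> exec (While b c) s 1 s"
| WhileTrue: "bval b s1 \<Longrightarrow> exec c s1 t1 s2 \<Longrightarrow> exec (While b c) s2 t2 s3 \<Longrightarrow>
     exec (While b c) s1 (Suc (t1 + t2)) s3"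

text \<open>
  The input store for an election whose candidates are labelled by \<open>lab\<close> with the numbers
  \<open>1, \<dots>, m\<close>: position \<open>r\<close> of a ranking, and position \<open>p\<close> of a given order, are counted from 1.
  Everything that is not part of the input is 0.
\<close>

definition input_store :: "('c \<Rightarrow> nat) \<Rightarrow> 'c election \<Rightarrow> store" where
  "input_store lab E = (\<lambda>x idx. case idx of
     [] \<Rightarrow> if x = ''n'' then num_voters E
           else if x = ''m'' then card (cands E)
           else if x = ''T'' then horizon E
           else 0
   | [j] \<Rightarrow> if x = ''kind'' \<and> j \<in> rounds E
            then (case given E j of Axis ax \<Rightarrow> 1 | Voter_Order vs \<Rightarrow> 2)
            else 0
   | [j, p] \<Rightarrow> if x = ''given'' \<and> j \<in> rounds E
               then (case given E j of
                   Axis ax \<Rightarrow> if p \<in> {1..length ax} then lab (ax ! (p - 1)) else 0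
                 | Voter_Order vs \<Rightarrow> if p \<in> {1..length vs} then vs ! (p - 1) else 0)
               else 0
   | [j, i, r] \<Rightarrow> if x = ''ranking'' \<and> j \<in> rounds E \<and> i \<in> voters E \<and> r \<in> {1..card (cands E)}
                  then lab (ranking E j i ! (r - 1))
                  else 0
   | _ \<Rightarrow> 0)"

text \<open>
  An election is described by \<open>\<Theta>(n m T)\<close> numbers, each at most \<open>max n m\<close>, so polynomial in the
  input length means polynomial in \<open>n + m + T\<close>.
\<close>

definition polynomial_time ::
  "('c election \<Rightarrow> bool) \<Rightarrow> ('c election \<Rightarrow> nat \<Rightarrow> 'c) \<Rightarrow> bool" where
  "polynomial_time D f \<longleftrightarrow>
     (\<exists>prog a d. \<forall>E lab. D E \<and> bij_betw lab (cands E) {1..card (cands E)} \<longrightarrow>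
        (\<exists>t s. exec prog (input_store lab E) t s \<and>
               t \<le> a * (num_voters E + card (cands E) + horizon E) ^ d \<and>
               (\<forall>j\<in>rounds E. s ''winner'' [j] = lab (f E j))))"

end

theory Submission
  imports Defs
begin

text \<open>
  If the winner, which is the first choice of the last paying voter \<open>v\<close>, is not Pareto efficient
  for \<open>S\<close>, then single-peakedness or single-crossingness puts all of \<open>S\<close> on one side of \<open>v\<close> in
  the payment order. So \<open>S\<close> either pays nothing in this round or has no budget left after it.
  Hence at most one inefficient round costs \<open>S\<close> anything, and then nothing of its budget remains;
  otherwise at most \<open>n\<close> units remain at the end. As no round costs \<open>S\<close> more than \<open>n\<close> units,
  \<open>S\<close> sees at least \<open>(|T| + 1) |S| / n - 1\<close> efficient rounds.
\<close>

section \<open>Positions in lists\<close>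

lemma pos_nth:
  assumes "distinct xs" "k < length xs"
  shows "pos xs (xs ! k) = k"
proof -
  have "xs = take k xs @ xs ! k # drop (Suc k) xs"
    using assms(2) by (simp add: id_take_nth_drop)
  moreover have "takeWhile (\<lambda>y. y \<noteq> xs ! k) (take k xs @ xs ! k # drop (Suc k) xs) = take k xs"
    using assms by (subst takeWhile_append2) (auto simp: in_set_conv_nth nth_eq_iff_index_eq)
  ultimately show ?thesis
    using assms(2) unfolding pos_def by (metis length_take min.absorb4)
qed

lemma pos_less_length: "x \<in> set xs \<Longrightarrow> pos xs x < length xs"
  unfolding pos_def by (induction xs) auto

lemma nth_pos: "x \<in> set xs \<Longrightarrow> xs ! pos xs x = x"
  unfolding pos_def by (induction xs) auto

text \<open>Bucket sort: taking the elements key by key, each bucket in list order, is sorted and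
  stable, which determines the result of \<open>sort_key\<close>. It links the declarative payment
  order on an axis to the program, which has no sorting and visits the voters bucket by
  bucket.\<close>

lemma sort_key_eq_concat_filter:
  assumes "\<And>x. x \<in> set xs \<Longrightarrow> f x < N"
  shows "sort_key f xs = concat (map (\<lambda>p. filter (\<lambda>x. f x = p) xs) [0..<N])"
proof (rule properties_for_sort_key)
  let ?c = "\<lambda>M. concat (map (\<lambda>p. filter (\<lambda>x. f x = p) xs) [0..<M])"
  \<comment> \<open>The properties are proved for the first \<open>M\<close> buckets, with
    \<open>M\<close> arbitrary, so that induction applies.\<close>
  have "mset (?c M) = mset (filter (\<lambda>x. f x < M) xs)" for M
    by (induction M) (auto intro!: multiset_eqI)
  moreover have "filter (\<lambda>x. f x < N) xs = xs"
    using assms by simp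
  ultimately show "mset (?c N) = mset xs"
    by metis
  show "filter (\<lambda>x. f k = f x) (?c N) = filter (\<lambda>x. f k = f x) xs" if "k \<in> set (?c N)" for k
  proof -
    have "filter (\<lambda>x. f k = f x) (?c M) = (if f k < M then filter (\<lambda>x. f k = f x) xs else [])" for M
      by (induction M) (auto simp: less_Suc_eq intro!: filter_cong)
    moreover have "f k < N"
      using that assms by auto
    ultimately show ?thesis
      by simp
  qed
  have "sorted (map f (?c M)) \<and> (\<forall>x\<in>set (?c M). f x < M)" for M
  proof (induction M)
    case (Suc M)
    have "sorted (map f (filter (\<lambda>x. f x = M) xs))"
      by (rule sorted_map_same)
    then show ?case
      using Suc by (auto simp: sorted_append less_Suc_eq less_imp_le)
  qed simp
  then show "sorted (map f (?c N))"
    by blast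
qed

lemma filter_eq_element:
  "distinct xs \<Longrightarrow> filter (\<lambda>i. i = a) xs = (if a \<in> set xs then [a] else [])"
  by (induction xs) auto


text \<open>A stable sort is determined by sortedness and by the order within each key class, and
  both depend only on the keys of list elements. This form suits keys taken from two elections that
  agree only on the voters.\<close>

lemma sort_key_cong:
  assumes "\<And>x. x \<in> set xs \<Longrightarrow> f x = g x"
  shows "sort_key f xs = sort_key g xs"
proof (rule properties_for_sort_key)
  show "filter (\<lambda>x. f k = f x) (sort_key g xs) = filter (\<lambda>x. f k = f x) xs"
    if "k \<in> set (sort_key g xs)" for k
  proof -
    have "filter (\<lambda>x. f k = f x) (sort_key g xs) = filter (\<lambda>x. g x = g k) (sort_key g xs)"
      using assms that by (intro filter_cong) auto
    also have "\<dots> = filter (\<lambda>x. g x = g k) xs"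
      by (rule sort_key_stable)
    also have "\<dots> = filter (\<lambda>x. f k = f x) xs"
      using assms that by (intro filter_cong) auto
    finally show ?thesis .
  qed
  have "map f (sort_key g xs) = map g (sort_key g xs)"
    using assms by simp
  then show "sorted (map f (sort_key g xs))"
    by (simp only: sorted_sort_key)
qed simp


section \<open>Deducting from budgets in order\<close>

lemma deduct_le: "deduct d is b i \<le> b i"
proof (induction "is" arbitrary: d b)
  case (Cons k "is")
  have "deduct (d - min d (b k)) is (b(k := b k - min d (b k))) i \<le> (b(k := b k - min d (b k))) i"
    by (rule Cons.IH)
  also have "\<dots> \<le> b i"
    by simp
  finally show ?case
    by (simp add: Let_def)
qed simp

lemma deduct_notin: "i \<notin> set is \<Longrightarrow> deduct d is b i = b i"
  by (induction "is" arbitrary: d b) (auto simp: Let_def)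

lemma deduct_0 [simp]: "deduct 0 is b = b"
  by (induction "is" arbitrary: b) auto

text \<open>Truncated subtraction also covers budgets that do not add up to \<open>d\<close>. By
  distinctness the head is charged only at its own turn, so its change does not affect the sum over
  the tail.\<close>

lemma sum_deduct:
  assumes "distinct is"
  shows "(\<Sum>i\<in>set is. deduct d is b i) = (\<Sum>i\<in>set is. b i) - d"
  using assms
proof (induction "is" arbitrary: d b)
  case (Cons k "is")
  define x where "x = min d (b k)"
  have "(\<Sum>i\<in>set is. deduct (d - x) is (b(k := b k - x)) i) = (\<Sum>i\<in>set is. b i) - (d - x)"
    using Cons by (auto simp: Cons.IH intro!: arg_cong2[where f = "(-)"] sum.cong)
  moreover have "deduct (d - x) is (b(k := b k - x)) k = b k - x"
    using Cons.prems by (simp add: deduct_notin)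
  ultimately show ?case
    using Cons.prems by (auto simp: Let_def x_def[symmetric]) (auto simp: x_def min_def)
qed simp

text \<open>\<open>v\<close> can be charged only if something is left to deduct when its turn comes,
  and then every earlier voter has been exhausted.\<close>

lemma deduct_before_payer:
  assumes "distinct (xs @ v # ys)" "deduct d (xs @ v # ys) b v < b v" "i \<in> set xs"
  shows "deduct d (xs @ v # ys) b i = 0"
  using assms
proof (induction xs arbitrary: d b)
  case (Cons k xs)
  define x where "x = min d (b k)"
  have step: "deduct d ((k # xs) @ v # ys) b = deduct (d - x) (xs @ v # ys) (b(k := b k - x))"
    by (simp add: Let_def x_def)
  have payer: "deduct (d - x) (xs @ v # ys) (b(k := b k - x)) v < (b(k := b k - x)) v"
    using Cons.prems unfolding step by auto
  show ?case
  proof (cases "i = k")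
    case True
    \<comment> \<open>If nothing were left after \<open>k\<close>, then \<open>deduct_0\<close>
      would leave the budget of \<open>v\<close> unchanged.\<close>
    have "d - x \<noteq> 0"
      using payer by auto
    then have "b k - x = 0"
      by (simp add: x_def)
    then show ?thesis
      using True deduct_le[of "d - x" "xs @ v # ys" "b(k := b k - x)" k] unfolding step by simp
  next
    case False
    then show ?thesis
      using Cons.IH[OF _ payer] Cons.prems unfolding step by (simp del: fun_upd_apply)
  qed
qed simp


section \<open>The voter sequence\<close>

lemma
  assumes "structured E" "j \<in> rounds E"
  shows distinct_voter_sequence: "distinct (voter_sequence E j)"
    and set_voter_sequence: "set (voter_sequence E j) = voters E"
  using assms
  by (auto simp: structured_def voter_sequence_def voters_def permutations_of_set_def
      split: given_order.splits dest!: bspec[of _ _ j])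

lemma
  assumes "structured E" "j \<in> rounds E" "i \<in> voters E"
  shows set_ranking: "set (ranking E j i) = cands E"
    and peak_eq_nth: "peak E j i = ranking E j i ! 0"
    and peak_in_cands: "peak E j i \<in> cands E"
    and pos_peak: "pos (ranking E j i) (peak E j i) = 0"
proof -
  have "ranking E j i \<in> permutations_of_set (cands E)" "card (cands E) \<ge> 1"
    using assms by (auto simp: structured_def is_election_def)
  then show *: "set (ranking E j i) = cands E"
    by (simp add: permutations_of_set_def)
  then have "ranking E j i \<noteq> []"
    using \<open>card (cands E) \<ge> 1\<close> by auto
  then show "peak E j i = ranking E j i ! 0" "peak E j i \<in> cands E"
      "pos (ranking E j i) (peak E j i) = 0"
    using * by (cases "ranking E j i"; auto simp: peak_def pos_def)+
qed

lemma budgets_le: "budgets E (Suc j) i \<le> budgets E j i"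
  by (simp add: deduct_le)

lemma num_voters_pos: "structured E \<Longrightarrow> 0 < num_voters E"
  by (auto simp: structured_def is_election_def)

text \<open>Voters start with enough for one round more than the horizon, so the total before each
  round exceeds \<open>n\<close> and the subtraction in \<open>sum_deduct\<close> is exact. After
  the last round \<open>n\<close> units remain.\<close>

lemma sum_budgets:
  assumes "structured E" "j \<le> horizon E"
  shows "(\<Sum>i\<in>voters E. budgets E j i) = num_voters E * (horizon E + 1 - j)"
  using assms(2)
proof (induction j)
  case (Suc j)
  then have "Suc j \<in> rounds E"
    by (simp add: rounds_def)
  then show ?case
    using sum_deduct[OF distinct_voter_sequence[OF assms(1)], of "Suc j"] Suc
    by (simp add: set_voter_sequence[OF assms(1)] Suc_diff_le algebra_simps)
qed (simp add: voters_def)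

text \<open>The electorate loses exactly \<open>n\<close> units and the voters outside
  \<open>S\<close> cannot gain, so \<open>S\<close> bears at most \<open>n\<close>.\<close>

lemma sum_budgets_step:
  assumes "structured E" "Suc j \<in> rounds E" "S \<subseteq> voters E"
  shows "(\<Sum>i\<in>S. budgets E j i) \<le> (\<Sum>i\<in>S. budgets E (Suc j) i) + num_voters E"
proof -
  let ?B = "\<lambda>k A. \<Sum>i\<in>A. budgets E k i"
  have fin: "finite (voters E)"
    by (simp add: voters_def)
  have split: "?B k (voters E) = ?B k S + ?B k (voters E - S)" for k
    using sum.subset_diff[OF assms(3) fin] by (simp add: add.commute)
  have "?B j (voters E) = ?B (Suc j) (voters E) + num_voters E"
    using sum_budgets[OF assms(1), of j] sum_budgets[OF assms(1), of "Suc j"] assms(2)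
    by (simp add: rounds_def Suc_diff_le algebra_simps del: budgets.simps)
  moreover have "?B (Suc j) (voters E - S) \<le> ?B j (voters E - S)"
    by (intro sum_mono budgets_le)
  ultimately show ?thesis
    using split[of j] split[of "Suc j"] by linarith
qed

lemma last_filter_split:
  assumes "filter P xs \<noteq> []"
  obtains ys zs where "xs = ys @ last (filter P xs) # zs" "P (last (filter P xs))"
    "\<And>z. z \<in> set zs \<Longrightarrow> \<not> P z"
proof -
  have "\<exists>x\<in>set xs. P x"
    using assms by (simp add: filter_empty_conv)
  then obtain ys v zs where *: "xs = ys @ v # zs" "P v" "\<forall>z\<in>set zs. \<not> P z"
    using split_list_last_prop[of xs P] by blast
  moreover have "last (filter P xs) = v"
    using * by (simp add: filter_empty_conv[THEN iffD2])
  ultimately show thesis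
    using that[of ys zs] by simp
qed

text \<open>The total budget falls by \<open>n > 0\<close>, so someone pays. This makes
  \<open>last\<close> in \<open>ordered_budget_rule\<close> meaningful.\<close>

lemma payers_nonempty:
  assumes "structured E" "Suc j \<in> rounds E"
  shows "filter (\<lambda>i. budgets E (Suc j) i < budgets E j i) (voter_sequence E (Suc j)) \<noteq> []"
proof -
  let ?P = "\<lambda>i. budgets E (Suc j) i < budgets E j i"
  have "(\<Sum>i\<in>voters E. budgets E (Suc j) i) < (\<Sum>i\<in>voters E. budgets E j i)"
    using sum_budgets[OF assms(1), of j] sum_budgets[OF assms(1), of "Suc j"] assms(2)
      num_voters_pos[OF assms(1)]
    by (simp add: rounds_def Suc_diff_le del: budgets.simps)
  then have "\<exists>i\<in>voters E. ?P i"
    by (meson not_less sum_mono)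
  then show ?thesis
    using set_voter_sequence[OF assms] by (auto simp: filter_empty_conv simp del: budgets.simps)
qed

text \<open>The interface to a single round. Voters before the last payer \<open>v\<close> are
  exhausted by \<open>deduct_before_payer\<close>; those after \<open>v\<close> pay nothing because
  \<open>v\<close> is the last to pay.\<close>

lemma payer_split:
  assumes "structured E" "Suc j \<in> rounds E"
  obtains xs v ys where "voter_sequence E (Suc j) = xs @ v # ys" "v \<in> voters E"
    "v = last (filter (\<lambda>i. budgets E (Suc j) i < budgets E j i) (voter_sequence E (Suc j)))"
    "ordered_budget_rule E (Suc j) = peak E (Suc j) v"
    "\<And>i. i \<in> set xs \<Longrightarrow> budgets E (Suc j) i = 0"
    "\<And>i. i \<in> set ys \<Longrightarrow> budgets E (Suc j) i = budgets E j i"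
proof -
  let ?L = "voter_sequence E (Suc j)" and ?P = "\<lambda>i. budgets E (Suc j) i < budgets E j i"
  obtain xs ys where L: "?L = xs @ last (filter ?P ?L) # ys" "?P (last (filter ?P ?L))"
      "\<And>z. z \<in> set ys \<Longrightarrow> \<not> ?P z"
    using last_filter_split[OF payers_nonempty[OF assms]] by blast
  define v where "v = last (filter ?P ?L)"
  note L = L[folded v_def]
  show thesis
  proof
    show "?L = xs @ v # ys" "v = last (filter ?P ?L)"
      by (fact L v_def)+
    show "v \<in> voters E"
      using L(1) set_voter_sequence[OF assms] by auto
    show "ordered_budget_rule E (Suc j) = peak E (Suc j) v"
      by (simp add: ordered_budget_rule_def v_def)
    show "budgets E (Suc j) i = 0" if "i \<in> set xs" for i
      using that deduct_before_payer[of xs v ys "num_voters E" "budgets E j" i] L(1,2)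
        distinct_voter_sequence[OF assms] by simp
    show "budgets E (Suc j) i = budgets E j i" if "i \<in> set ys" for i
      using L(3)[OF that] budgets_le[of E j i] by linarith
  qed
qed

lemma rule_in_cands:
  assumes "structured E" "j \<in> rounds E"
  shows "ordered_budget_rule E j \<in> cands E"
proof -
  obtain k where k: "j = Suc k"
    using assms(2) by (cases j) (auto simp: rounds_def)
  obtain v where "v \<in> voters E" "ordered_budget_rule E (Suc k) = peak E (Suc k) v"
    by (rule payer_split[OF assms(1) assms(2)[unfolded k]]) (rule that)
  then show ?thesis
    using peak_in_cands[OF assms] k by simp
qed


section \<open>Pareto efficiency\<close>

text \<open>On an axis, a voter whose peak is that of \<open>v\<close>, or lies on the other side of
  it than \<open>c\<close>, meets the peak of \<open>v\<close> before \<open>c\<close> and cannot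
  prefer \<open>c\<close>. So all peaks of \<open>S\<close> lie strictly on the side of
  \<open>c\<close>. With a voter order, those who prefer \<open>c\<close> form a prefix or suffix
  that misses \<open>v\<close>, hence lies entirely before or after \<open>v\<close>.\<close>

lemma inefficient_one_side:
  assumes "structured E" "j \<in> rounds E" "S \<subseteq> voters E" "S \<noteq> {}"
    and L: "voter_sequence E j = xs @ v # ys"
    and c: "c \<in> cands E" "\<And>i. i \<in> S \<Longrightarrow> prefers E j i c (peak E j v)"
  shows "S \<subseteq> set xs \<or> S \<subseteq> set ys"
proof -
  have setL: "set xs \<union> {v} \<union> set ys = voters E"
    using set_voter_sequence[OF assms(1,2)] L by auto
  then have v: "v \<in> voters E"
    by blast
  have vc: "\<not> prefers E j v c (peak E j v)"
    using pos_peak[OF assms(1,2) v] by (simp add: prefers_def)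
  show ?thesis
  proof (cases "given E j")
    case (Axis ax)
    let ?f = "\<lambda>i. pos ax (peak E j i)"
    have ax: "set ax = cands E" "single_peaked E j ax"
      using assms(1,2) Axis by (auto simp: structured_def permutations_of_set_def dest!: bspec[of _ _ j])
    have "sorted (map ?f (xs @ v # ys))"
      unfolding L[symmetric] using Axis by (simp add: voter_sequence_def)
    then have sorted: "\<And>i. i \<in> set xs \<Longrightarrow> ?f i \<le> ?f v" "\<And>i. i \<in> set ys \<Longrightarrow> ?f v \<le> ?f i"
      by (auto simp: sorted_append)
    have peaked: "\<not> prefers E j i c (peak E j v)"
      if "i \<in> voters E"
        "?f i \<le> ?f v \<and> ?f v < pos ax c \<or> pos ax c < ?f v \<and> ?f v \<le> ?f i" for i
      using ax(2) that c(1) peak_in_cands[OF assms(1,2) v]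
      unfolding single_peaked_def prefers_def by (meson less_asym)
    obtain i where "i \<in> S"
      using assms(4) by blast
    then have "c \<noteq> peak E j v"
      using c(2) by (auto simp: prefers_def)
    then have "pos ax c \<noteq> ?f v"
      using nth_pos[of _ ax] ax(1) c(1) peak_in_cands[OF assms(1,2) v] by metis
    then consider "pos ax c < ?f v" | "?f v < pos ax c"
      by linarith
    then show ?thesis
    proof cases
      case 1
      have "i \<in> set xs" if "i \<in> S" for i
      proof -
        have i: "i \<in> voters E" "prefers E j i c (peak E j v)"
          using that assms(3) c(2) by blast+
        \<comment> \<open>The negation is strict: no voter of \<open>S\<close> shares the peak of
          \<open>v\<close>. Voters who do share it may stand on either side of \<open>v\<close> in
          the sequence.\<close>
        then have "\<not> ?f v \<le> ?f i"
          using peaked[of i] 1 by blast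
        then have "i \<notin> set ys" "i \<noteq> v"
          using sorted(2) by blast+
        then show ?thesis
          using setL i(1) by blast
      qed
      then show ?thesis
        by blast
    next
      case 2
      have "i \<in> set ys" if "i \<in> S" for i
      proof -
        have i: "i \<in> voters E" "prefers E j i c (peak E j v)"
          using that assms(3) c(2) by blast+
        then have "\<not> ?f i \<le> ?f v"
          using peaked[of i] 2 by blast
        then have "i \<notin> set xs" "i \<noteq> v"
          using sorted(1) by blast+
        then show ?thesis
          using setL i(1) by blast
      qed
      then show ?thesis
        by blast
    qed
  next
    case (Voter_Order vs)
    then have vs: "vs = xs @ v # ys" "single_crossing E j vs"
      using assms(1,2) L by (auto simp: structured_def voter_sequence_def dest!: bspec[of _ _ j])
    let ?A = "{i \<in> voters E. prefers E j i c (peak E j v)}"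
    have sub: "S \<subseteq> ?A" "v \<notin> ?A"
      using c(2) assms(3) vc by auto
    obtain k where "?A = set (take k vs) \<or> ?A = set (drop k vs)"
      using vs(2) c(1) peak_in_cands[OF assms(1,2) v] unfolding single_crossing_def by blast
    then show ?thesis
    proof
      assume A: "?A = set (take k vs)"
      \<comment> \<open>A longer prefix would contain \<open>v\<close>, who ranks her own peak
        first.\<close>
      then have "k \<le> length xs"
        using sub(2) unfolding vs(1) by (cases "k - length xs") auto
      then show ?thesis
        using A sub(1) set_take_subset[of k xs] unfolding vs(1) by auto
    next
      assume A: "?A = set (drop k vs)"
      \<comment> \<open>A suffix starting at or before the position \<open>length xs\<close> of
        \<open>v\<close> would contain \<open>v\<close>.\<close>
      then have "k > length xs"
        using sub(2) unfolding vs(1) by (cases "k - length xs") auto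
      then have "drop k vs = drop (k - Suc (length xs)) ys"
        unfolding vs(1) by (simp add: drop_Cons')
      then have "set (drop k vs) \<subseteq> set ys"
        by (simp add: set_drop_subset)
      then show ?thesis
        using A sub(1) by blast
    qed
  qed
qed

lemma sum_budgets_inefficient:
  assumes "structured E" "Suc j \<in> rounds E" "is_group E S"
    and "\<not> pareto_efficient E (Suc j) S (ordered_budget_rule E (Suc j))"
  shows "(\<Sum>i\<in>S. budgets E (Suc j) i) = (\<Sum>i\<in>S. budgets E j i) \<or>
         (\<Sum>i\<in>S. budgets E (Suc j) i) = 0"
proof -
  have S: "S \<noteq> {}" "S \<subseteq> voters E"
    using assms(3) by (auto simp: is_group_def)
  obtain xs v ys where L: "voter_sequence E (Suc j) = xs @ v # ys"
    and w: "ordered_budget_rule E (Suc j) = peak E (Suc j) v"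
    and b: "\<And>i. i \<in> set xs \<Longrightarrow> budgets E (Suc j) i = 0"
      "\<And>i. i \<in> set ys \<Longrightarrow> budgets E (Suc j) i = budgets E j i"
    by (rule payer_split[OF assms(1,2)]) (rule that)
  obtain c where "c \<in> cands E" "\<forall>i\<in>S. prefers E (Suc j) i c (peak E (Suc j) v)"
    using assms(4) rule_in_cands[OF assms(1,2)] unfolding pareto_efficient_def w by blast
  then have "S \<subseteq> set xs \<or> S \<subseteq> set ys"
    using inefficient_one_side[OF assms(1,2) S(2,1) L] by blast
  then show ?thesis
  proof
    assume "S \<subseteq> set xs"
    then have "(\<Sum>i\<in>S. budgets E (Suc j) i) = 0"
      using b(1) by (intro sum.neutral) blast
    then show ?thesis ..
  next
    assume "S \<subseteq> set ys"
    then have "(\<Sum>i\<in>S. budgets E (Suc j) i) = (\<Sum>i\<in>S. budgets E j i)"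
      using b(2) by (intro sum.cong) blast+
    then show ?thesis ..
  qed
qed

text \<open>The second disjunct describes the time after an inefficient round that cost \<open>S\<close> something.\<close>

lemma budget_invariant:
  assumes "structured E" "is_group E S" "j \<le> horizon E"
  defines "K \<equiv> \<lambda>j. card {k \<in> {1..j}. pareto_efficient E k S (ordered_budget_rule E k)}"
  shows "card S * (horizon E + 1) \<le> (\<Sum>i\<in>S. budgets E j i) + num_voters E * K j \<or>
    (\<Sum>i\<in>S. budgets E j i) = 0 \<and> card S * (horizon E + 1) \<le> num_voters E * (K j + 1)"
  using assms(3)
proof (induction j)
  case (Suc j)
  let ?eff = "\<lambda>k. pareto_efficient E k S (ordered_budget_rule E k)"
  have r: "Suc j \<in> rounds E"
    using Suc.prems by (simp add: rounds_def)
  have "{k \<in> {1..Suc j}. ?eff k} = {k \<in> {1..j}. ?eff k} \<union> (if ?eff (Suc j) then {Suc j} else {})"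
    by (auto simp: le_Suc_eq)
  then have K: "K (Suc j) = (if ?eff (Suc j) then K j + 1 else K j)"
    unfolding K_def by simp
  have mono: "(\<Sum>i\<in>S. budgets E (Suc j) i) \<le> (\<Sum>i\<in>S. budgets E j i)"
    by (intro sum_mono budgets_le)
  have step: "(\<Sum>i\<in>S. budgets E j i) \<le> (\<Sum>i\<in>S. budgets E (Suc j) i) + num_voters E"
    using sum_budgets_step[OF assms(1) r] assms(2) by (simp add: is_group_def)
  show ?case
  proof (cases "?eff (Suc j)")
    case True
    then show ?thesis
      using Suc mono step by (auto simp: K algebra_simps simp del: budgets.simps)
  next
    case False
    \<comment> \<open>If this round empties \<open>S\<close> while the first disjunct held, then
      \<open>S\<close> had at most \<open>n\<close> units before it by \<open>step\<close>. These
      account for the \<open>+ 1\<close> in the second disjunct.\<close>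
    then show ?thesis
      using Suc mono step sum_budgets_inefficient[OF assms(1) r assms(2) False]
      by (auto simp: K algebra_simps simp del: budgets.simps)
  qed
qed simp

text \<open>At the end both disjuncts of \<open>budget_invariant\<close> give the same bound: in the
  first, \<open>S\<close> holds at most the \<open>n\<close> units that remain in total.\<close>

lemma pareto_rounds:
  assumes "structured E" "is_group E S"
  shows "card S * (horizon E + 1) \<le> num_voters E *
    (card {j \<in> rounds E. pareto_efficient E j S (ordered_budget_rule E j)} + 1)"
proof -
  have "(\<Sum>i\<in>S. budgets E (horizon E) i) \<le> (\<Sum>i\<in>voters E. budgets E (horizon E) i)"
    using assms(2) by (intro sum_mono2) (auto simp: is_group_def voters_def)
  also have "\<dots> = num_voters E"
    using sum_budgets[OF assms(1)] by simp
  finally show ?thesis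
    using budget_invariant[OF assms order_refl] unfolding rounds_def
    by (auto simp: algebra_simps)
qed

lemma pareto_rounds_ceiling:
  assumes "structured E" "is_group E S"
  shows "int (card {j \<in> rounds E. pareto_efficient E j S (ordered_budget_rule E j)})
    \<ge> \<lceil>(real (horizon E) + 1) * real (card S) / real (num_voters E)\<rceil> - 1"
proof -
  let ?k = "card {j \<in> rounds E. pareto_efficient E j S (ordered_budget_rule E j)}"
  have "real (card S * (horizon E + 1)) \<le> real (num_voters E * (?k + 1))"
    using pareto_rounds[OF assms] of_nat_le_iff by blast
  then have "(real (horizon E) + 1) * real (card S) / real (num_voters E) \<le> of_int (int ?k + 1)"
    using num_voters_pos[OF assms(1)] by (simp add: field_simps)
  then show ?thesis
    using ceiling_le by fastforce
qed

section \<open>From Pareto efficiency to all-rank-wPJR\<close>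

lemma mem_take_iff_pos:
  "x \<in> set (take r xs) \<longleftrightarrow> x \<in> set xs \<and> pos xs x < r"
proof (induction xs arbitrary: r)
  case (Cons a xs)
  then show ?case
    by (cases r) (auto simp: pos_def)
qed simp

text \<open>A candidate common to all the top sets would be ranked above \<open>w\<close> by every
  member of \<open>S\<close> if \<open>w\<close> lay outside all of them.\<close>

lemma pareto_efficient_in_top_sets:
  assumes "structured E" "j \<in> rounds E" "is_group E S"
    and "(\<Inter>i\<in>S. top_set E j i (r i)) \<noteq> {}" "pareto_efficient E j S w"
  shows "w \<in> (\<Union>i\<in>S. top_set E j i (r i))"
proof (rule ccontr)
  assume w: "w \<notin> (\<Union>i\<in>S. top_set E j i (r i))"
  obtain c where c: "\<And>i. i \<in> S \<Longrightarrow> c \<in> top_set E j i (r i)"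
    using assms(4) by blast
  have S: "S \<subseteq> voters E" "S \<noteq> {}"
    using assms(3) by (auto simp: is_group_def)
  have wc: "w \<in> cands E"
    using assms(5) by (simp add: pareto_efficient_def)
  have "c \<in> cands E \<and> prefers E j i c w" if "i \<in> S" for i
  proof -
    have "set (ranking E j i) = cands E"
      using set_ranking[OF assms(1,2)] S(1) that by blast
    moreover have "c \<in> top_set E j i (r i)" "w \<notin> top_set E j i (r i)"
      using c w that by blast+
    ultimately show ?thesis
      using wc by (simp add: top_set_def mem_take_iff_pos prefers_def)
  qed
  then show False
    using assms(5) S(2) unfolding pareto_efficient_def by blast
qed

lemma all_rank_wPJR_Droop_rule:
  assumes "structured E"
  shows "all_rank_wPJR_Droop E (ordered_budget_rule E)"
  unfolding all_rank_wPJR_Droop_def all_rank_wPJR_sized_def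
proof (intro allI impI, elim conjE)
  fix R :: "nat \<Rightarrow> nat \<Rightarrow> nat" and l S
  let ?W = "ordered_budget_rule E"
  let ?k = "card {j \<in> rounds E. pareto_efficient E j S (?W j)}"
  assume S: "is_group E S"
    and large: "real (card S) > real l * real (num_voters E) / (real (horizon E) + 1)"
    and common: "\<forall>j\<in>rounds E. (\<Inter>i\<in>S. top_set E j i (R j i)) \<noteq> {}"
  have "real l * real (num_voters E) < real (card S) * (real (horizon E) + 1)"
    using large by (simp add: pos_divide_less_eq)
  then have "real (num_voters E * l) < real (card S * (horizon E + 1))"
    by (simp add: algebra_simps)
  then have "num_voters E * l < num_voters E * (?k + 1)"
    using pareto_rounds[OF assms S] by linarith
  \<comment> \<open>The strict Droop inequality yields \<open>l < ?k + 1\<close>, which makes up for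
    the one round lost in \<open>pareto_rounds\<close>.\<close>
  then have "l \<le> ?k"
    by (metis Suc_eq_plus1 less_Suc_eq_le mult_less_cancel1)
  also have "?k \<le> card {j \<in> rounds E. ?W j \<in> (\<Union>i\<in>S. top_set E j i (R j i))}"
    using pareto_efficient_in_top_sets[OF assms _ S] common
    by (intro card_mono) (auto simp: rounds_def)
  finally show "l \<le> card {j \<in> rounds E. ?W j \<in> (\<Union>i\<in>S. top_set E j i (R j i))}" .
qed

text \<open>For \<open>l > 0\<close> the Droop threshold is strictly below \<open>l n / T\<close>,
  so a group that meets the weak inequality for the latter meets the strict one for the
  former.\<close>

lemma all_rank_wPJR_if_Droop:
  assumes "structured E" "all_rank_wPJR_Droop E W"
  shows "all_rank_wPJR E W"
proof -
  have "real l * real (num_voters E) / (real (horizon E) + 1)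
      < real l * real (num_voters E) / real (horizon E)" if "l \<ge> 1" for l
    using assms(1) that by (intro divide_strict_left_mono) (auto simp: structured_def is_election_def)
  then have "real l * real (num_voters E) / (real (horizon E) + 1) < real (card S)"
    if "l \<ge> 1" "real l * real (num_voters E) / real (horizon E) \<le> real (card S)"
    for l and S :: "nat set"
    using that less_le_trans by blast
  then show ?thesis
    using assms(2) unfolding all_rank_wPJR_def all_rank_wPJR_Droop_def all_rank_wPJR_sized_def
    by simp
qed


section \<open>Semi-onlineness\<close>

lemma voter_sequence_cong:
  assumes "num_voters E = num_voters E'" "given E j = given E' j"
    and "\<And>i. i \<in> voters E \<Longrightarrow> ranking E j i = ranking E' j i"
  shows "voter_sequence E j = voter_sequence E' j"
proof -
  have "sort_key (\<lambda>i. pos ax (peak E j i)) [1..<Suc (num_voters E)] =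
      sort_key (\<lambda>i. pos ax (peak E' j i)) [1..<Suc (num_voters E)]" for ax
    using assms(3) by (intro sort_key_cong) (auto simp: peak_def voters_def)
  then show ?thesis
    using assms(1,2) by (simp add: voter_sequence_def del: upt_Suc split: given_order.split)
qed

lemma semi_online_rule: "semi_online structured ordered_budget_rule"
  unfolding semi_online_def
proof (intro allI impI ballI, elim conjE)
  fix E E' :: "'c election" and j
  assume E: "structured E" "num_voters E = num_voters E'" "horizon E = horizon E'" "j \<in> rounds E"
    and eq: "\<forall>k\<in>{1..j}. given E k = given E' k \<and> (\<forall>i\<in>voters E. ranking E k i = ranking E' k i)"
  have L: "voter_sequence E k = voter_sequence E' k" if "k \<in> {1..j}" for k
    using eq that E(2) by (intro voter_sequence_cong) auto
  have b: "budgets E k = budgets E' k" if "k \<le> j" for k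
    using that by (induction k) (auto simp: E L)
  obtain k where k: "j = Suc k"
    using E(4) by (cases j) (auto simp: rounds_def)
  \<comment> \<open>The two elections agree only on the rankings of voters, so the equality of peaks
    requires that the last payer is a voter.\<close>
  obtain v where v: "v \<in> voters E"
    "v = last (filter (\<lambda>i. budgets E (Suc k) i < budgets E k i) (voter_sequence E (Suc k)))"
    by (rule payer_split[OF E(1) E(4)[unfolded k]]) (rule that)
  have "ordered_budget_rule E j = peak E j v" "ordered_budget_rule E' j = peak E' j v"
    using v(2) b[of j] b[of k] L[of j] k by (simp_all add: ordered_budget_rule_def del: budgets.simps)
  then show "ordered_budget_rule E j = ordered_budget_rule E' j"
    using eq v(1) k by (simp add: peak_def)
qed


section \<open>A program for the rule\<close>

definition halts_within :: "com \<Rightarrow> nat \<Rightarrow> (store \<Rightarrow> bool) \<Rightarrow> store \<Rightarrow> bool" where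
  "halts_within c t Q s \<longleftrightarrow> (\<exists>t' s'. exec c s t' s' \<and> t' \<le> t \<and> Q s')"

lemma halts_within_Skip: "Q s \<Longrightarrow> halts_within Skip 1 Q s"
  unfolding halts_within_def using exec.Skip by blast

text \<open>Index and value enter through equations, so that the new store can be described by
  mathematical terms instead of \<open>aval\<close> expressions.\<close>

lemma halts_within_Assign:
  assumes "map (\<lambda>e. aval e s) es = idx" "aval e s = v" "Q (s(x := (s x)(idx := v)))"
  shows "halts_within (Assign x es e) 1 Q s"
  using assms exec.Assign[of x es e s] unfolding halts_within_def by blast

text \<open>With the store as last argument, \<open>halts_within c2 t2 Q\<close> is itself a
  predicate on stores and serves as the postcondition of \<open>c1\<close>.\<close>

lemma halts_within_Seq:
  assumes "halts_within c1 t1 (halts_within c2 t2 Q) s"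
  shows "halts_within (Seq c1 c2) (t1 + t2) Q s"
proof -
  obtain u1 s1 u2 s2 where "exec c1 s u1 s1" "u1 \<le> t1" "exec c2 s1 u2 s2" "u2 \<le> t2" "Q s2"
    using assms unfolding halts_within_def by blast
  then have "exec (Seq c1 c2) s (u1 + u2) s2" "u1 + u2 \<le> t1 + t2" "Q s2"
    by (simp_all add: exec.Seq add_mono)
  then show ?thesis
    unfolding halts_within_def by blast
qed

lemma halts_within_Cond:
  assumes "bval b s \<Longrightarrow> halts_within c1 t Q s" "\<not> bval b s \<Longrightarrow> halts_within c2 t Q s"
  shows "halts_within (Cond b c1 c2) (Suc t) Q s"
  using assms unfolding halts_within_def
  by (cases "bval b s") (blast intro: exec.CondTrue exec.CondFalse Suc_le_mono[THEN iffD2])+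

lemma halts_within_mono:
  assumes "halts_within c t Q s" "t \<le> t'" "\<And>s. Q s \<Longrightarrow> Q' s"
  shows "halts_within c t' Q' s"
proof -
  obtain u s1 where "exec c s u s1" "u \<le> t" "Q s1"
    using assms(1) unfolding halts_within_def by blast
  then have "exec c s u s1 \<and> u \<le> t' \<and> Q' s1"
    using assms(2,3) by simp
  then show ?thesis
    unfolding halts_within_def by blast
qed

text \<open>The invariant carries the iteration count, so it also yields termination. Each of the
  \<open>N\<close> iterations costs one test and at most \<open>B\<close> steps; the failing test
  adds one.\<close>

lemma halts_within_While:
  assumes guard: "\<And>k s. I k s \<Longrightarrow> bval g s \<longleftrightarrow> k < N"
    and body: "\<And>k s. I k s \<Longrightarrow> k < N \<Longrightarrow> halts_within c B (I (Suc k)) s"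
    and init: "I 0 s"
  shows "halts_within (While g c) (Suc (N * Suc B)) (I N) s"
proof -
  \<comment> \<open>Induction on the number \<open>r\<close> of remaining iterations, since the
    store at the loop head varies.\<close>
  have "halts_within (While g c) (Suc (r * Suc B)) (I N) s" if "I k s" "k + r = N" for k r s
    using that
  proof (induction r arbitrary: k s)
    case 0
    then have "exec (While g c) s 1 s"
      using guard by (intro exec.WhileFalse) auto
    then show ?case
      using 0 unfolding halts_within_def by auto
  next
    case (Suc r)
    then have "k < N"
      by simp
    then obtain t1 s1 where 1: "exec c s t1 s1" "t1 \<le> B" "I (Suc k) s1"
      using body Suc.prems(1) unfolding halts_within_def by blast
    obtain t2 s2 where 2: "exec (While g c) s1 t2 s2" "t2 \<le> Suc (r * Suc B)" "I N s2"
      using Suc.IH[OF 1(3)] Suc.prems(2) unfolding halts_within_def by auto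
    have "exec (While g c) s (Suc (t1 + t2)) s2"
      using guard Suc.prems(1) \<open>k < N\<close> 1(1) 2(1) by (intro exec.WhileTrue) auto
    moreover have "Suc (t1 + t2) \<le> Suc (Suc r * Suc B)"
      using 1(2) 2(2) by simp
    ultimately show ?case
      using 2(3) unfolding halts_within_def by blast
  qed
  then show ?thesis
    using init by simp
qed

section \<open>The program text\<close>

abbreviation Scalar :: "string \<Rightarrow> aexp" where
  "Scalar x \<equiv> Arr x []"

text \<open>
  The array \<open>spent\<close> holds what was deducted so far, so its initial value 0 is correct. With
  truncated subtraction, \<open>d - (d - b)\<close> is the minimum of \<open>d\<close> and \<open>b\<close>.
\<close>

definition pay_code :: com where
  "pay_code =
     Seq (Assign ''x'' [] (Sub (Scalar ''d'') (Sub (Scalar ''d'')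
            (Sub (Add (Scalar ''T'') (Num 1)) (Arr ''spent'' [Scalar ''i''])))))
    (Seq (Assign ''spent'' [Scalar ''i''] (Add (Arr ''spent'' [Scalar ''i'']) (Scalar ''x'')))
    (Seq (Assign ''d'' [] (Sub (Scalar ''d'') (Scalar ''x'')))
         (Cond (Less (Num 0) (Scalar ''x''))
           (Assign ''winner'' [Scalar ''j''] (Arr ''ranking'' [Scalar ''j'', Scalar ''i'', Num 1]))
           Skip)))"

text \<open>The payment order is produced by search: for each position \<open>p\<close> of the given
  order, all voters are compared in index order with the entry there. On an axis this is the bucket
  sort of \<open>sort_key_eq_concat_filter\<close>.\<close>

definition visit_code :: com where
  "visit_code =
     Seq (Assign ''i'' [] (Add (Scalar ''i'') (Num 1)))
    (Seq (Cond (Equal (Arr ''kind'' [Scalar ''j'']) (Num 1))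
           (Assign ''key'' [] (Arr ''ranking'' [Scalar ''j'', Scalar ''i'', Num 1]))
           (Assign ''key'' [] (Scalar ''i'')))
         (Cond (Equal (Scalar ''key'') (Arr ''given'' [Scalar ''j'', Scalar ''p'']))
           pay_code Skip))"

definition scan_code :: com where
  "scan_code =
     Seq (Assign ''p'' [] (Add (Scalar ''p'') (Num 1)))
    (Seq (Assign ''i'' [] (Num 0))
         (While (Less (Scalar ''i'') (Scalar ''n'')) visit_code))"

text \<open>An axis has \<open>m\<close> entries and a voter order has \<open>n\<close>, so
  \<open>m + n\<close> positions suffice for both kinds.\<close>

definition round_code :: com where
  "round_code =
     Seq (Assign ''j'' [] (Add (Scalar ''j'') (Num 1)))
    (Seq (Assign ''d'' [] (Scalar ''n''))
    (Seq (Assign ''p'' [] (Num 0))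
         (While (Less (Scalar ''p'') (Add (Scalar ''m'') (Scalar ''n''))) scan_code)))"

definition rule_code :: com where
  "rule_code = While (Less (Scalar ''j'') (Scalar ''T'')) round_code"

section \<open>The effect of a round on the abstract state\<close>

definition pay :: "(nat \<Rightarrow> 'a) \<Rightarrow> nat \<Rightarrow> nat \<times> (nat \<Rightarrow> nat) \<times> 'a \<Rightarrow> nat \<times> (nat \<Rightarrow> nat) \<times> 'a" where
  "pay h i = (\<lambda>(d, b, w). let x = min d (b i) in
     (d - x, b(i := b i - x), if 0 < x then h i else w))"

text \<open>Each payer overwrites the provisional winner, so charging the voters one at a time
  leaves the choice of the last payer. This turns the rule, which looks for the last payer after the
  round, into a single pass.\<close>

lemma fold_pay:
  assumes "distinct is"
  shows "\<exists>d'. fold (pay h) is (d, b, w) = (d', deduct d is b,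
    let ps = filter (\<lambda>i. deduct d is b i < b i) is in if ps = [] then w else h (last ps))"
  using assms
proof (induction "is" arbitrary: d b w)
  case (Cons k "is")
  define x where "x = min d (b k)"
  define b' where "b' = b(k := b k - x)"
  have k: "k \<notin> set is"
    using Cons.prems by simp
  have ded: "deduct d (k # is) b = deduct (d - x) is b'"
    by (simp add: Let_def x_def b'_def)
  have "deduct (d - x) is b' k = b k - x"
    using k by (simp add: deduct_notin b'_def)
  \<comment> \<open>As \<open>x\<close> is at most \<open>b k\<close>, the budget of
    \<open>k\<close> decreases exactly when \<open>x\<close> is positive.\<close>
  then have "deduct (d - x) is b' k < b k \<longleftrightarrow> 0 < x"
    by (auto simp: x_def)
  moreover have "filter (\<lambda>i. deduct (d - x) is b' i < b i) is = filter (\<lambda>i. deduct (d - x) is b' i < b' i) is"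
    using k by (intro filter_cong) (auto simp: b'_def)
  moreover have "fold (pay h) (k # is) (d, b, w) =
      fold (pay h) is (d - x, b', if 0 < x then h k else w)"
    by (simp add: pay_def Let_def x_def b'_def)
  ultimately show ?case
    using Cons.IH[of "d - x" b' "if 0 < x then h k else w"] Cons.prems unfolding ded
    by (auto simp: Let_def)
qed simp

definition scan_key :: "('c \<Rightarrow> nat) \<Rightarrow> 'c election \<Rightarrow> nat \<Rightarrow> nat \<Rightarrow> nat" where
  "scan_key lab E j i = (case given E j of Axis ax \<Rightarrow> lab (peak E j i) | Voter_Order vs \<Rightarrow> i)"

text \<open>The bound \<open>k\<close> limits the scan to the first \<open>k\<close> voters, as
  needed for the invariant of the inner loop.\<close>

definition scan_hits :: "('c \<Rightarrow> nat) \<Rightarrow> 'c election \<Rightarrow> nat \<Rightarrow> nat \<Rightarrow> nat \<Rightarrow> nat list" where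
  "scan_hits lab E j p k =
     filter (\<lambda>i. scan_key lab E j i = input_store lab E ''given'' [j, p]) [1..<Suc k]"

text \<open>Entries of the given order beyond its length read 0 and match no voter.\<close>

lemma concat_scan_hits:
  assumes E: "structured E" "j \<in> rounds E" and lab: "bij_betw lab (cands E) {1..card (cands E)}"
  shows "concat (map (\<lambda>p. scan_hits lab E j (Suc p) (num_voters E))
    [0..<card (cands E) + num_voters E]) = voter_sequence E j"
proof (cases "given E j")
  case (Axis ax)
  let ?n = "num_voters E" and ?m = "card (cands E)"
  have ax: "set ax = cands E" "distinct ax" "length ax = ?m"
    using E Axis by (auto simp: structured_def permutations_of_set_def distinct_card[symmetric]
        dest!: bspec[of _ _ j])
  \<comment> \<open>The hits at entry \<open>Suc p\<close>, counted from 1, are the bucket of voters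
    whose peak has position \<open>p\<close>, counted from 0.\<close>
  have "scan_hits lab E j (Suc p) ?n = filter (\<lambda>i. pos ax (peak E j i) = p) [1..<Suc ?n]" for p
    unfolding scan_hits_def
  proof (rule filter_cong[OF refl])
    fix i assume "i \<in> set [1..<Suc ?n]"
    then have peak: "peak E j i \<in> set ax"
      using peak_in_cands[OF E] ax(1) by (auto simp: voters_def)
    show "(scan_key lab E j i = input_store lab E ''given'' [j, Suc p]) = (pos ax (peak E j i) = p)"
    proof (cases "p < ?m")
      case True
      then have "lab (peak E j i) = lab (ax ! p) \<longleftrightarrow> peak E j i = ax ! p"
        using lab peak ax by (intro inj_on_eq_iff[of lab "cands E"]) (auto simp: bij_betw_def)
      also have "\<dots> \<longleftrightarrow> pos ax (peak E j i) = p"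
        using pos_nth[OF ax(2)] nth_pos[OF peak] True ax(3) by metis
      finally show ?thesis
        using True Axis E(2) ax(3) by (simp add: scan_key_def input_store_def)
    next
      case False
      \<comment> \<open>Labels start at 1, so none equals the default 0 read beyond the end of the
        axis.\<close>
      have "lab (peak E j i) \<noteq> 0"
        using lab peak ax(1) by (force simp: bij_betw_def)
      moreover have "pos ax (peak E j i) \<noteq> p"
        using pos_less_length[OF peak] False ax(3) by simp
      ultimately show ?thesis
        using False Axis E(2) ax(3) by (simp add: scan_key_def input_store_def)
    qed
  qed
  moreover have "pos ax (peak E j i) < ?m + ?n" if "i \<in> set [1..<Suc ?n]" for i
    using that pos_less_length[of "peak E j i" ax] peak_in_cands[OF E] ax
    by (fastforce simp: voters_def)
  then have "sort_key (\<lambda>i. pos ax (peak E j i)) [1..<Suc ?n] =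
      concat (map (\<lambda>p. filter (\<lambda>i. pos ax (peak E j i) = p) [1..<Suc ?n]) [0..<?m + ?n])"
    by (rule sort_key_eq_concat_filter)
  ultimately show ?thesis
    using Axis by (simp add: voter_sequence_def del: upt_Suc)
next
  case (Voter_Order vs)
  let ?n = "num_voters E" and ?m = "card (cands E)"
  have vs: "set vs = voters E" "distinct vs"
    using E Voter_Order by (auto simp: structured_def permutations_of_set_def dest!: bspec[of _ _ j])
  then have len: "length vs = ?n"
    using distinct_card[of vs] by (simp add: voters_def)
  have hits: "scan_hits lab E j (Suc p) ?n = (if p < ?n then [vs ! p] else [])" for p
  proof -
    \<comment> \<open>Beyond the end of \<open>vs\<close> the entry reads 0, which is not the number
      of a voter.\<close>
    have "scan_hits lab E j (Suc p) ?n =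
        filter (\<lambda>i. i = (if p < ?n then vs ! p else 0)) [1..<Suc ?n]"
      using Voter_Order E(2) len by (auto simp: scan_hits_def scan_key_def input_store_def)
    moreover have "vs ! p \<in> {1..?n}" if "p < ?n"
      using that nth_mem[of p vs] vs(1) len by (simp add: voters_def)
    ultimately show ?thesis
      by (subst (asm) filter_eq_element) auto
  qed
  have "concat (map (\<lambda>p. scan_hits lab E j (Suc p) ?n) [0..<N]) = take N vs" for N
    by (induction N) (auto simp: hits take_Suc_conv_app_nth len)
  then show ?thesis
    using Voter_Order len by (simp add: voter_sequence_def)
qed

section \<open>Invariants and correctness of the program\<close>

definition input_kept :: "('c \<Rightarrow> nat) \<Rightarrow> 'c election \<Rightarrow> store \<Rightarrow> bool" where
  "input_kept lab E s \<longleftrightarrow>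
     (\<forall>x\<in>{''n'', ''m'', ''T'', ''kind'', ''given'', ''ranking''}. s x = input_store lab E x)"

text \<open>The invariant within round \<open>j\<close>, for both inner loops: the entry of
  \<open>winner\<close> at \<open>j\<close> is provisional, earlier ones are final. Between rounds,
  \<open>rounds_done\<close> takes its place.\<close>

definition tracks :: "('c \<Rightarrow> nat) \<Rightarrow> 'c election \<Rightarrow> nat \<Rightarrow> nat \<times> (nat \<Rightarrow> nat) \<times> nat \<Rightarrow> store \<Rightarrow> bool" where
  "tracks lab E j = (\<lambda>(d, b, w) s. input_kept lab E s \<and> s ''j'' [] = j \<and> s ''d'' [] = d \<and>
     (\<forall>i. horizon E + 1 - s ''spent'' [i] = b i) \<and> s ''winner'' [j] = w \<and>
     (\<forall>k\<in>{1..<j}. s ''winner'' [k] = lab (ordered_budget_rule E k)))"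

lemma input_store_simps:
  "input_store lab E ''n'' [] = num_voters E"
  "input_store lab E ''m'' [] = card (cands E)"
  "input_store lab E ''T'' [] = horizon E"
  by (simp_all add: input_store_def)

lemma input_store_ranking:
  assumes "structured E" "j \<in> rounds E" "i \<in> voters E"
  shows "input_store lab E ''ranking'' [j, i, Suc 0] = lab (peak E j i)"
proof -
  have "1 \<le> card (cands E)"
    using assms(1) by (simp add: structured_def is_election_def)
  then show ?thesis
    using assms peak_eq_nth[OF assms] by (simp add: input_store_def)
qed

lemma halts_pay_code:
  assumes "structured E" "j \<in> rounds E" "i \<in> voters E"
    and "tracks lab E j st s" "s ''i'' [] = i" "s ''p'' [] = p"
  shows "halts_within pay_code 5
    (\<lambda>s. tracks lab E j (pay (\<lambda>i. lab (peak E j i)) i st) s \<and> s ''i'' [] = i \<and> s ''p'' [] = p) s"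
proof -
  obtain d b w where st: "st = (d, b, w)"
    by (cases st)
  have s: "input_kept lab E s" "s ''j'' [] = j" "s ''d'' [] = d" "s ''winner'' [j] = w"
      "\<And>i. horizon E + 1 - s ''spent'' [i] = b i"
    using assms(4) by (auto simp: st tracks_def)
  have inp: "s ''T'' [] = horizon E" "s ''ranking'' [j, i, Suc 0] = lab (peak E j i)"
    using s(1) input_store_ranking[OF assms(1-3)] by (simp_all add: input_kept_def input_store_simps)
  define x where "x = min d (b i)"
  define s1 where "s1 = s(''x'' := (s ''x'')([] := x))"
  define s2 where "s2 = s1(''spent'' := (s1 ''spent'')([i] := s ''spent'' [i] + x))"
  define s3 where "s3 = s2(''d'' := (s2 ''d'')([] := d - x))"
  define s4 where "s4 = s3(''winner'' := (s3 ''winner'')([j] := lab (peak E j i)))"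
  let ?Q = "\<lambda>s. tracks lab E j (pay (\<lambda>i. lab (peak E j i)) i st) s \<and> s ''i'' [] = i \<and> s ''p'' [] = p"
  have s1: "s1 ''i'' [] = i" "s1 ''spent'' [i] = s ''spent'' [i]" "s1 ''x'' [] = x"
      "s1 ''j'' [] = j" "s1 ''d'' [] = d" "s1 ''winner'' = s ''winner''" "s1 ''p'' [] = p"
      "s1 ''spent'' = s ''spent''" "s1 ''ranking'' = s ''ranking''" "input_kept lab E s1"
    using s assms(5,6) by (auto simp: s1_def input_kept_def)
  have s2: "s2 ''i'' [] = i" "s2 ''x'' [] = x" "s2 ''j'' [] = j" "s2 ''d'' [] = d"
      "s2 ''winner'' = s ''winner''" "s2 ''p'' [] = p" "s2 ''ranking'' = s ''ranking''"
      "s2 ''spent'' = (s ''spent'')([i] := s ''spent'' [i] + x)" "input_kept lab E s2"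
    using s1 by (auto simp: s2_def input_kept_def)
  have s3: "s3 ''i'' [] = i" "s3 ''x'' [] = x" "s3 ''j'' [] = j" "s3 ''d'' [] = d - x"
      "s3 ''winner'' = s ''winner''" "s3 ''p'' [] = p" "s3 ''ranking'' = s ''ranking''"
      "s3 ''spent'' = (s ''spent'')([i] := s ''spent'' [i] + x)" "input_kept lab E s3"
    using s2 by (auto simp: s3_def input_kept_def)
  have s4: "s4 ''i'' [] = i" "s4 ''j'' [] = j" "s4 ''d'' [] = d - x"
      "s4 ''winner'' = (s ''winner'')([j] := lab (peak E j i))" "s4 ''p'' [] = p"
      "s4 ''spent'' = (s ''spent'')([i] := s ''spent'' [i] + x)" "input_kept lab E s4"
    using s3 by (auto simp: s4_def input_kept_def)
  have spent: "horizon E + 1 - ((s ''spent'')([i] := s ''spent'' [i] + x)) [k] = (b(i := b i - x)) k" for k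
    using s(5)[of k] by auto
  have winners: "\<forall>k\<in>{1..<j}. s ''winner'' [k] = lab (ordered_budget_rule E k)"
    using assms(4) by (simp add: st tracks_def)
  have pay: "pay (\<lambda>i. lab (peak E j i)) i st =
      (d - x, b(i := b i - x), if 0 < x then lab (peak E j i) else w)"
    by (simp add: st pay_def x_def Let_def)
  have Q: "?Q s3" if "x = 0"
    unfolding pay tracks_def using that s3 spent winners s(4) by auto
  have Q': "?Q s4" if "0 < x"
    unfolding pay tracks_def using that s4 spent winners by auto
  have "halts_within (Cond (Less (Num 0) (Scalar ''x''))
      (Assign ''winner'' [Scalar ''j''] (Arr ''ranking'' [Scalar ''j'', Scalar ''i'', Num 1]))
      Skip) (Suc 1) ?Q s3"
  proof (rule halts_within_Cond)
    assume "bval (Less (Num 0) (Scalar ''x'')) s3"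
    then have "?Q s4"
      using Q' s3(2) by simp
    then show "halts_within (Assign ''winner'' [Scalar ''j'']
        (Arr ''ranking'' [Scalar ''j'', Scalar ''i'', Num 1])) 1 ?Q s3"
      unfolding s4_def using s3 inp by (intro halts_within_Assign) auto
  next
    assume "\<not> bval (Less (Num 0) (Scalar ''x'')) s3"
    then show "halts_within Skip 1 ?Q s3"
      using Q s3(2) by (intro halts_within_Skip) auto
  qed
  \<comment> \<open>Three assignments, the test and one branch.\<close>
  then have "halts_within pay_code (1 + (1 + (1 + Suc 1))) ?Q s"
    unfolding pay_code_def s3_def s2_def s1_def
    apply (intro halts_within_Seq)
    apply (rule halts_within_Assign[where idx = "[]" and v = x])
      apply simp
    subgoal
      using s(3) s(5)[of i] inp assms(5) by (simp add: x_def)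
    apply (rule halts_within_Seq)
    apply (rule halts_within_Assign[where idx = "[i]" and v = "s ''spent'' [i] + x"])
    subgoal
      using s1(1) by (simp add: s1_def)
    subgoal
      using s1(1-3) by (simp add: s1_def)
    apply (rule halts_within_Seq)
    apply (rule halts_within_Assign[where idx = "[]" and v = "d - x"])
      apply simp
    subgoal
      using s2(2,4) by (simp add: s2_def s1_def)
    apply assumption
    done
  then show ?thesis
    by (simp add: numeral_eq_Suc)
qed

lemma halts_visit_code:
  assumes "structured E" "j \<in> rounds E" "Suc k \<in> voters E"
    and "tracks lab E j (fold (pay (\<lambda>i. lab (peak E j i))) (scan_hits lab E j p k) st) s"
    and "s ''i'' [] = k" "s ''p'' [] = p"
  shows "halts_within visit_code 9
    (\<lambda>s. tracks lab E j (fold (pay (\<lambda>i. lab (peak E j i))) (scan_hits lab E j p (Suc k)) st) s \<and>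
      s ''i'' [] = Suc k \<and> s ''p'' [] = p) s"
proof -
  let ?h = "\<lambda>i. lab (peak E j i)"
  let ?st = "fold (pay ?h) (scan_hits lab E j p k) st"
  obtain d b w where st: "?st = (d, b, w)"
    by (cases ?st)
  let ?Q = "\<lambda>s. tracks lab E j (fold (pay ?h) (scan_hits lab E j p (Suc k)) st) s \<and>
      s ''i'' [] = Suc k \<and> s ''p'' [] = p"
  \<comment> \<open>One more voter adds at most one hit, so each visit makes at most one
    payment.\<close>
  have hits: "scan_hits lab E j p (Suc k) = scan_hits lab E j p k @
      (if scan_key lab E j (Suc k) = input_store lab E ''given'' [j, p] then [Suc k] else [])"
    by (simp add: scan_hits_def)
  have s: "input_kept lab E s" "s ''j'' [] = j"
    using assms(4) by (auto simp: st tracks_def)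
  have inp: "s ''given'' [j, p] = input_store lab E ''given'' [j, p]"
      "s ''ranking'' [j, Suc k, Suc 0] = lab (peak E j (Suc k))"
      "s ''kind'' [j] = Suc 0 \<longleftrightarrow> (\<exists>ax. given E j = Axis ax)"
  proof -
    have keep: "s ''given'' = input_store lab E ''given''" "s ''ranking'' = input_store lab E ''ranking''"
        "s ''kind'' = input_store lab E ''kind''"
      using s(1) by (simp_all add: input_kept_def)
    show "s ''given'' [j, p] = input_store lab E ''given'' [j, p]"
        "s ''ranking'' [j, Suc k, Suc 0] = lab (peak E j (Suc k))"
      using input_store_ranking[OF assms(1-3)] by (simp_all only: keep)
    show "s ''kind'' [j] = Suc 0 \<longleftrightarrow> (\<exists>ax. given E j = Axis ax)"
      unfolding keep using assms(2) by (cases "given E j") (simp_all add: input_store_def)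
  qed
  define s1 where "s1 = s(''i'' := (s ''i'')([] := Suc k))"
  define s2 where "s2 = s1(''key'' := (s1 ''key'')([] := scan_key lab E j (Suc k)))"
  have s2: "tracks lab E j ?st s2" "s2 ''i'' [] = Suc k" "s2 ''p'' [] = p"
      "s2 ''j'' [] = j" "s2 ''key'' [] = scan_key lab E j (Suc k)"
      "s2 ''given'' [j, p] = input_store lab E ''given'' [j, p]"
    using assms(4-6) s inp by (auto simp: st tracks_def input_kept_def s2_def s1_def)
  have last: "halts_within (Cond (Equal (Scalar ''key'') (Arr ''given'' [Scalar ''j'', Scalar ''p'']))
      pay_code Skip) (Suc 5) ?Q s2"
  proof (rule halts_within_Cond)
    assume "bval (Equal (Scalar ''key'') (Arr ''given'' [Scalar ''j'', Scalar ''p''])) s2"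
    then show "halts_within pay_code 5 ?Q s2"
      using halts_pay_code[OF assms(1-3) s2(1-3)] s2 by (simp add: hits)
  next
    assume "\<not> bval (Equal (Scalar ''key'') (Arr ''given'' [Scalar ''j'', Scalar ''p''])) s2"
    then have "halts_within Skip 1 ?Q s2"
      using s2 by (intro halts_within_Skip) (simp add: hits)
    then show "halts_within Skip 5 ?Q s2"
      by (rule halts_within_mono) auto
  qed
  \<comment> \<open>The increment, the choice of the key with its test, and the comparison followed
    by at most the 5 steps of \<open>pay_code\<close>.\<close>
  have "halts_within visit_code (1 + (Suc 1 + Suc 5)) ?Q s"
    unfolding visit_code_def
  proof (intro halts_within_Seq halts_within_Assign)
    show "map (\<lambda>e. aval e s) [] = []" "aval (Add (Scalar ''i'') (Num 1)) s = Suc k"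
      using assms(5) by simp_all
    have s1: "s1 ''i'' [] = Suc k" "s1 ''j'' [] = j" "s1 ''kind'' = s ''kind''" "s1 ''ranking'' = s ''ranking''"
      using s by (simp_all add: s1_def)
    show "halts_within (Cond (Equal (Arr ''kind'' [Scalar ''j'']) (Num 1))
           (Assign ''key'' [] (Arr ''ranking'' [Scalar ''j'', Scalar ''i'', Num 1]))
           (Assign ''key'' [] (Scalar ''i''))) (Suc 1) (halts_within
       (Cond (Equal (Scalar ''key'') (Arr ''given'' [Scalar ''j'', Scalar ''p''])) pay_code Skip)
       (Suc 5) ?Q) (s(''i'' := (s ''i'')([] := Suc k)))"
      unfolding s1_def[symmetric]
    proof (rule halts_within_Cond)
      assume "bval (Equal (Arr ''kind'' [Scalar ''j'']) (Num 1)) s1"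
      then show "halts_within (Assign ''key'' [] (Arr ''ranking'' [Scalar ''j'', Scalar ''i'', Num 1])) 1
          (halts_within (Cond (Equal (Scalar ''key'') (Arr ''given'' [Scalar ''j'', Scalar ''p''])) pay_code Skip)
            (Suc 5) ?Q) s1"
        using s1 inp last unfolding s2_def
        by (intro halts_within_Assign) (auto simp: scan_key_def)
    next
      assume "\<not> bval (Equal (Arr ''kind'' [Scalar ''j'']) (Num 1)) s1"
      then show "halts_within (Assign ''key'' [] (Scalar ''i'')) 1
          (halts_within (Cond (Equal (Scalar ''key'') (Arr ''given'' [Scalar ''j'', Scalar ''p''])) pay_code Skip)
            (Suc 5) ?Q) s1"
        using s1 inp last unfolding s2_def
        by (intro halts_within_Assign) (auto simp: scan_key_def split: given_order.split)
    qed
  qed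
  then show ?thesis
    by (simp add: numeral_eq_Suc)
qed

lemma halts_scan_code:
  assumes "structured E" "j \<in> rounds E"
    and "tracks lab E j st s" "s ''p'' [] = p"
  shows "halts_within scan_code (3 + 10 * num_voters E)
    (\<lambda>s. tracks lab E j (fold (pay (\<lambda>i. lab (peak E j i)))
        (scan_hits lab E j (Suc p) (num_voters E)) st) s \<and> s ''p'' [] = Suc p) s"
proof -
  let ?h = "\<lambda>i. lab (peak E j i)" and ?n = "num_voters E"
  let ?I = "\<lambda>k s. tracks lab E j (fold (pay ?h) (scan_hits lab E j (Suc p) k) st) s \<and>
      s ''i'' [] = k \<and> s ''p'' [] = Suc p"
  have n: "s ''n'' [] = ?n" if "tracks lab E j st' s" for s st'
    using that by (cases st') (simp add: tracks_def input_kept_def input_store_simps)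
  have loop: "halts_within (While (Less (Scalar ''i'') (Scalar ''n'')) visit_code)
      (Suc (?n * Suc 9)) (?I ?n) s'" if "?I 0 s'" for s'
  proof (rule halts_within_While[where I = ?I])
    show "bval (Less (Scalar ''i'') (Scalar ''n'')) s = (k < ?n)" if "?I k s" for k s
      using that n[of _ s] by (elim conjE) simp
    show "halts_within visit_code 9 (?I (Suc k)) s" if "?I k s" "k < ?n" for k s
      using that by (intro halts_visit_code[OF assms(1,2)]) (auto simp: voters_def)
    show "?I 0 s'"
      by (fact that)
  qed
  \<comment> \<open>Two assignments, then \<open>n\<close> visits of 9 steps with one test each, and
    the failing test.\<close>
  have "halts_within scan_code (1 + (1 + Suc (?n * Suc 9))) (?I ?n) s"
    unfolding scan_code_def
  proof (intro halts_within_Seq halts_within_Assign loop)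
    show "aval (Add (Scalar ''p'') (Num 1)) s = Suc p"
      using assms(4) by simp
  qed (use assms(3) in \<open>cases st; simp add: tracks_def input_kept_def scan_hits_def\<close>)+
  then show ?thesis
    by (rule halts_within_mono) auto
qed

definition rounds_done :: "('c \<Rightarrow> nat) \<Rightarrow> 'c election \<Rightarrow> nat \<Rightarrow> store \<Rightarrow> bool" where
  "rounds_done lab E j s \<longleftrightarrow> input_kept lab E s \<and> s ''j'' [] = j \<and>
     (\<forall>i. horizon E + 1 - s ''spent'' [i] = budgets E j i) \<and>
     (\<forall>k\<in>{1..j}. s ''winner'' [k] = lab (ordered_budget_rule E k))"

lemma halts_round_code:
  assumes "structured E" "Suc j \<in> rounds E" "bij_betw lab (cands E) {1..card (cands E)}"
    and "rounds_done lab E j s0"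
  shows "halts_within round_code
    (4 + (card (cands E) + num_voters E) * (4 + 10 * num_voters E)) (rounds_done lab E (Suc j)) s0"
proof -
  let ?h = "\<lambda>i. lab (peak E (Suc j) i)" and ?n = "num_voters E" and ?m = "card (cands E)"
  let ?hits = "\<lambda>q. concat (map (\<lambda>p. scan_hits lab E (Suc j) (Suc p) ?n) [0..<q])"
  \<comment> \<open>The third component is whatever the store holds at this entry; it is overwritten
    because some voter pays, by \<open>payers_nonempty\<close>.\<close>
  define st where "st = (?n, budgets E j, s0 ''winner'' [Suc j])"
  let ?I = "\<lambda>q s. tracks lab E (Suc j) (fold (pay ?h) (?hits q) st) s \<and> s ''p'' [] = q"
  have mn: "s ''n'' [] = ?n" "s ''m'' [] = ?m" if "tracks lab E (Suc j) st' s" for s st'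
    using that by (cases st'; simp add: tracks_def input_kept_def input_store_simps)+
  have loop: "halts_within (While (Less (Scalar ''p'') (Add (Scalar ''m'') (Scalar ''n''))) scan_code)
      (Suc ((?m + ?n) * Suc (3 + 10 * ?n))) (?I (?m + ?n)) s'" if "?I 0 s'" for s'
  proof (rule halts_within_While[where I = ?I])
    show "bval (Less (Scalar ''p'') (Add (Scalar ''m'') (Scalar ''n''))) s = (q < ?m + ?n)"
      if "?I q s" for q s
      using that mn[of _ s] by (elim conjE) simp
    show "halts_within scan_code (3 + 10 * ?n) (?I (Suc q)) s" if "?I q s" for q s
      using that halts_scan_code[OF assms(1,2), of lab "fold (pay ?h) (?hits q) st" s q] by simp
    show "?I 0 s'"
      by (fact that)
  qed
  have run: "halts_within round_code (1 + (1 + (1 + Suc ((?m + ?n) * Suc (3 + 10 * ?n))))) (?I (?m + ?n)) s0"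
    unfolding round_code_def
  proof (intro halts_within_Seq halts_within_Assign loop)
    show "aval (Add (Scalar ''j'') (Num 1)) s0 = Suc j"
      using assms(4) by (simp add: rounds_done_def)
  qed (use assms(4) in \<open>auto simp: tracks_def input_kept_def rounds_done_def st_def input_store_simps\<close>)
  have finished: "rounds_done lab E (Suc j) s" if "?I (?m + ?n) s" for s
  proof -
    have "tracks lab E (Suc j) (fold (pay ?h) (voter_sequence E (Suc j)) st) s"
      using that concat_scan_hits[OF assms(1-3)] by simp
    moreover have "\<exists>d. fold (pay ?h) (voter_sequence E (Suc j)) st =
        (d, budgets E (Suc j), lab (ordered_budget_rule E (Suc j)))"
    proof -
      let ?ps = "filter (\<lambda>i. budgets E (Suc j) i < budgets E j i) (voter_sequence E (Suc j))"
      have "\<exists>d. fold (pay ?h) (voter_sequence E (Suc j)) st =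
          (d, budgets E (Suc j), if ?ps = [] then s0 ''winner'' [Suc j] else ?h (last ?ps))"
        using fold_pay[OF distinct_voter_sequence[OF assms(1,2)], of ?h ?n "budgets E j"]
        unfolding st_def budgets.simps(2) Let_def .
      moreover have "ordered_budget_rule E (Suc j) = peak E (Suc j) (last ?ps)"
        by (simp add: ordered_budget_rule_def)
      ultimately show ?thesis
        using payers_nonempty[OF assms(1,2)] by simp
    qed
    ultimately show ?thesis
      by (auto simp: tracks_def rounds_done_def le_Suc_eq simp del: budgets.simps)
  qed
  show ?thesis
    by (rule halts_within_mono[OF run _ finished]) simp
qed

section \<open>The polynomial time bound\<close>

lemma polynomial_time_rule: "polynomial_time structured ordered_budget_rule"
  unfolding polynomial_time_def
\<comment> \<open>Degree 3 comes from the nested loops over rounds, positions and voters. With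
  \<open>N = n + m + T\<close> the bound expands to \<open>1 + 5 N + 4 N^2 + 10 N^3\<close>, which
  is at most \<open>20 N^3\<close>, so the factor 30 leaves slack.\<close>
proof (rule exI[of _ rule_code], rule exI[of _ 30], rule exI[of _ 3], intro allI impI, elim conjE)
  fix E :: "'c election" and lab
  assume E: "structured E" and lab: "bij_betw lab (cands E) {1..card (cands E)}"
  let ?n = "num_voters E" and ?m = "card (cands E)" and ?T = "horizon E"
  let ?B = "4 + (?m + ?n) * (4 + 10 * ?n)"
  have "halts_within rule_code (Suc (?T * Suc ?B)) (rounds_done lab E ?T) (input_store lab E)"
    unfolding rule_code_def
  proof (rule halts_within_While)
    show "bval (Less (Scalar ''j'') (Scalar ''T'')) s = (k < ?T)" if "rounds_done lab E k s" for k s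
      using that by (simp add: rounds_done_def input_kept_def input_store_simps)
    show "halts_within round_code ?B (rounds_done lab E (Suc k)) s"
      if "rounds_done lab E k s" "k < ?T" for k s
      using that by (intro halts_round_code[OF E _ lab]) (auto simp: rounds_def)
    show "rounds_done lab E 0 (input_store lab E)"
      by (simp add: rounds_done_def input_kept_def input_store_def)
  qed
  moreover have "Suc (?T * Suc ?B) \<le> 30 * (?n + ?m + ?T) ^ 3"
  proof -
    define N where "N = ?n + ?m + ?T"
    have N: "1 \<le> N"
      using num_voters_pos[OF E] by (simp add: N_def)
    have "Suc (?T * Suc ?B) \<le> 1 + N * (5 + N * (4 + 10 * N))"
      by (simp add: add_mono mult_le_mono N_def)
    also have "\<dots> \<le> 30 * N ^ 3"
    proof -
      have "N \<le> N * N" "N * N \<le> N * N * N"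
        using N by auto
      moreover have "1 + N * (5 + N * (4 + 10 * N)) = 1 + 5 * N + 4 * (N * N) + 10 * (N * N * N)"
        by (simp add: algebra_simps)
      ultimately show ?thesis
        using N unfolding power3_eq_cube by linarith
    qed
    finally show ?thesis
      by (simp add: N_def)
  qed
  ultimately show "\<exists>t s. exec rule_code (input_store lab E) t s \<and> t \<le> 30 * (?n + ?m + ?T) ^ 3 \<and>
      (\<forall>j\<in>rounds E. s ''winner'' [j] = lab (ordered_budget_rule E j))"
    unfolding halts_within_def rounds_done_def rounds_def by (meson order_trans)
qed

theorem theorem5p6:
  shows "rule_on (structured :: 'c election \<Rightarrow> bool) ordered_budget_rule \<and>
     polynomial_time (structured :: 'c election \<Rightarrow> bool) ordered_budget_rule \<and>
     semi_online (structured :: 'c election \<Rightarrow> bool) ordered_budget_rule \<and>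
     (\<forall>E :: 'c election. structured E \<longrightarrow>
        (\<forall>S. is_group E S \<longrightarrow>
           int (card {j \<in> rounds E. pareto_efficient E j S (ordered_budget_rule E j)})
             \<ge> \<lceil>(real (horizon E) + 1) * real (card S) / real (num_voters E)\<rceil> - 1) \<and>
        all_rank_wPJR E (ordered_budget_rule E) \<and>
        all_rank_wPJR_Droop E (ordered_budget_rule E))"
proof (intro conjI allI impI)
  show "rule_on (structured :: 'c election \<Rightarrow> bool) ordered_budget_rule"
    unfolding rule_on_def using rule_in_cands by blast
qed (rule polynomial_time_rule semi_online_rule pareto_rounds_ceiling all_rank_wPJR_Droop_rule
    all_rank_wPJR_if_Droop[OF _ all_rank_wPJR_Droop_rule]; assumption)+

end
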